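(* $\overline\tau(K_n) = \Omega(\log\log\log n)$; that is, there is a constant $c>0$ such that for all sufficiently large $n$, every edge-ordered straight-line drawing of $K_n$ contains a non-crossing monotone complete binary tree with at least $c\log\log\log n$ vertices.
   Context: A geometric graph is a graph whose vertices are points in the plane in general position and whose edges are straight line segments; a straight-line drawing of $G$ is a geometric graph isomorphic to $G$. An edge-ordering is a total order on the edges. In an edge-ordered graph, a path $v_1v_2\ldots v_k$ is increasing if $(v_iv_{i+1}) > (v_{i+1}v_{i+2})$ for all $i=1,\ldots,k-2$ and decreasing if $(v_iv_{i+1}) < (v_{i+1}v_{i+2})$ for all $i$. All binary trees are complete and rooted (every internal vertex has exactly two children and all leaves are at the same depth); the size of a tree is its number of vertices. A rooted tree is increasing (resp. decreasing) if every path from the root to a leaf is increasing (resp. decreasing), and monotone if it is increasing or decreasing. A tree in a geometric graph is non-crossing if no two of its edges cross. $\overline\tau(\widetilde G)$ is the minimum over all edge-orderings of $\widetilde G$ of the maximum size of a non-crossing monotone binary tree in $\widetilde G$, and $\overline\tau(G)$ is the minimum of $\overline\tau(\widetilde G)$ over all straight-line drawings $\widetilde G$ of $G$. *)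

theory Defs
  imports
    "HOL-Analysis.Analysis"
    "HOL-Library.Landau_Symbols"
    "HOL-Library.Ramsey"
    "HOL-Library.Tree"
begin

section \<open>Finite simple graphs\<close>

type_synonym 'v graph = "'v set \<times> 'v set set"

abbreviation verts :: "'v graph \<Rightarrow> 'v set" where "verts \<equiv> fst"
abbreviation edges :: "'v graph \<Rightarrow> 'v set set" where "edges \<equiv> snd"

definition fin_simple_graph :: "'v graph \<Rightarrow> bool" where
  "fin_simple_graph G \<longleftrightarrow> finite (verts G) \<and> edges G \<subseteq> nsets (verts G) 2"

definition graph_isomorphic :: "'v graph \<Rightarrow> 'w graph \<Rightarrow> bool" where
  "graph_isomorphic G H \<longleftrightarrow>
     (\<exists>f. bij_betw f (verts G) (verts H) \<and> edges H = (`) f ` edges G)"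

definition complete_simple_graph :: "nat \<Rightarrow> nat graph" where
  "complete_simple_graph n = ({..<n}, nsets {..<n} 2)"

section \<open>Geometric graphs\<close>

definition general_position :: "(real^2) set \<Rightarrow> bool" where
  "general_position P \<longleftrightarrow> (\<forall>T\<in>nsets P 3. \<not> collinear T)"

definition geometric_graph :: "(real^2) graph \<Rightarrow> bool" where
  "geometric_graph D \<longleftrightarrow> fin_simple_graph D \<and> general_position (verts D)"

definition straight_line_drawing :: "(real^2) graph \<Rightarrow> 'v graph \<Rightarrow> bool" where
  "straight_line_drawing D G \<longleftrightarrow> geometric_graph D \<and> graph_isomorphic G D"

text \<open>The edge \<open>{a, b}\<close> is drawn as the segment from \<open>a\<close> to \<open>b\<close>.  Since no three vertices are
  collinear, a common point of two distinct edges is either a common endpoint, which is not a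
  crossing, or interior to both.\<close>

definition edges_cross :: "(real^2) set \<Rightarrow> (real^2) set \<Rightarrow> bool" where
  "edges_cross e f \<longleftrightarrow> e \<noteq> f \<and>
     (\<exists>a b c d. e = {a, b} \<and> f = {c, d} \<and> open_segment a b \<inter> open_segment c d \<noteq> {})"

definition non_crossing :: "(real^2) set set \<Rightarrow> bool" where
  "non_crossing F \<longleftrightarrow> (\<forall>e\<in>F. \<forall>f\<in>F. \<not> edges_cross e f)"

section \<open>Edge-orderings and monotone paths\<close>

text \<open>\<open>(e, f) \<in> r\<close> means \<open>e \<le> f\<close>.\<close>

definition edge_ordering :: "'v graph \<Rightarrow> 'v set rel \<Rightarrow> bool" where
  "edge_ordering G r \<longleftrightarrow> linear_order_on (edges G) r"

text \<open>The convention followed here is that the edges of an increasing path get smaller along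
  the path.\<close>

definition increasing_path :: "'v set rel \<Rightarrow> 'v list \<Rightarrow> bool" where
  "increasing_path r vs \<longleftrightarrow> (\<forall>i. i + 2 < length vs \<longrightarrow>
     ({vs ! (i + 1), vs ! (i + 2)}, {vs ! i, vs ! (i + 1)}) \<in> r - Id)"

definition decreasing_path :: "'v set rel \<Rightarrow> 'v list \<Rightarrow> bool" where
  "decreasing_path r vs \<longleftrightarrow> (\<forall>i. i + 2 < length vs \<longrightarrow>
     ({vs ! i, vs ! (i + 1)}, {vs ! (i + 1), vs ! (i + 2)}) \<in> r - Id)"

section \<open>Complete binary trees in a graph\<close>

text \<open>A rooted binary tree is a nonempty value of type \<open>'v tree\<close> whose \<open>Node\<close>s carry the
  vertices; \<open>size\<close> counts these.  The constructor \<open>Leaf\<close> marks the absence of a vertex, so the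
  leaves of the tree are the nodes of the form \<open>Node Leaf v Leaf\<close>.  For a nonempty tree
  \<open>Tree.complete\<close> then says that every other node has two children and that all leaves have the
  same depth.\<close>

fun root_edge :: "'v \<Rightarrow> 'v tree \<Rightarrow> 'v set set" where
  "root_edge v Leaf = {}"
| "root_edge v (Node l w r) = {{v, w}}"

fun tree_edges :: "'v tree \<Rightarrow> 'v set set" where
  "tree_edges Leaf = {}"
| "tree_edges (Node l v r) = root_edge v l \<union> root_edge v r \<union> tree_edges l \<union> tree_edges r"

fun root_leaf_paths :: "'v tree \<Rightarrow> 'v list set" where
  "root_leaf_paths Leaf = {}"
| "root_leaf_paths (Node l v r) =
     (if l = Leaf \<and> r = Leaf then {[v]} else (#) v ` (root_leaf_paths l \<union> root_leaf_paths r))"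

definition binary_tree_in :: "'v tree \<Rightarrow> 'v graph \<Rightarrow> bool" where
  "binary_tree_in t G \<longleftrightarrow> t \<noteq> Leaf \<and> Tree.complete t \<and> distinct (inorder t) \<and>
     set_tree t \<subseteq> verts G \<and> tree_edges t \<subseteq> edges G"

definition monotone_tree :: "'v set rel \<Rightarrow> 'v tree \<Rightarrow> bool" where
  "monotone_tree r t \<longleftrightarrow>
     (\<forall>p\<in>root_leaf_paths t. increasing_path r p) \<or> (\<forall>p\<in>root_leaf_paths t. decreasing_path r p)"

section \<open>The parameter\<close>

definition max_tree_size :: "(real^2) graph \<Rightarrow> (real^2) set rel \<Rightarrow> nat" where
  "max_tree_size D r =
     Max {size t | t. binary_tree_in t D \<and> non_crossing (tree_edges t) \<and> monotone_tree r t}"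

text \<open>On nonempty sets of natural numbers \<open>Inf\<close> is the minimum.\<close>

definition tau_bar_geom :: "(real^2) graph \<Rightarrow> nat" where
  "tau_bar_geom D = Inf {max_tree_size D r | r. edge_ordering D r}"

definition tau_bar :: "'v graph \<Rightarrow> nat" where
  "tau_bar G = Inf {tau_bar_geom D | D. straight_line_drawing D G}"

end

theory Submission
  imports Defs "HOL-Real_Asymp.Real_Asymp"
begin

text \<open>Number the points of the drawing arbitrarily and colour each triple \<open>i < j < l\<close> with one of
  four colours, recording its orientation and whether the edge \<open>ij\<close> precedes the edge \<open>jl\<close>.  By the
  Erdos--Rado bound there is a homogeneous set of \<open>k = \<Omega>(ln (ln n))\<close> points.  Equal orientations
  put these points in convex position in cyclic order, so a complete binary tree labelled in
  preorder is drawn without crossings.  Labels grow along its root-to-leaf paths, so the equal edge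
  comparisons make it monotone.  This even gives the bound \<open>\<Omega>(ln (ln n))\<close>.\<close>

section \<open>A quantitative Ramsey theorem for hypergraphs\<close>

text \<open>The Erdos-Rado condition that the colour of an \<open>r + 1\<close>-set ignores its top
  element. Tops range over a separate set \<open>X\<close>, so that candidates still available are
  covered along with the points already chosen in \<open>B\<close>.\<close>

definition end_homogeneous :: "('a::linorder set \<Rightarrow> 'b) \<Rightarrow> nat \<Rightarrow> 'a set \<Rightarrow> 'a set \<Rightarrow> bool" where
  "end_homogeneous c r B X \<longleftrightarrow>
     (\<forall>T\<in>nsets B r. \<forall>x\<in>X. \<forall>y\<in>X. (\<forall>t\<in>T. t < x \<and> t < y) \<longrightarrow> c (insert x T) = c (insert y T))"

lemma end_homogeneousD:
  "end_homogeneous c r B X \<Longrightarrow> T \<in> nsets B r \<Longrightarrow> x \<in> X \<Longrightarrow> y \<in> X \<Longrightarrow>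
     \<forall>t\<in>T. t < x \<and> t < y \<Longrightarrow> c (insert x T) = c (insert y T)"
  unfolding end_homogeneous_def by blast

text \<open>Greedy selection: \<open>B\<close> holds the chosen points, \<open>R\<close> the
  candidates, and \<open>j\<close> counts the choices still to be made. Each choice moves the least
  candidate to \<open>B\<close> and keeps one pigeonhole class of the others, which costs a factor
  \<open>q ^ (m ^ r)\<close>. The candidate \<open>z\<close> left at the end serves as a common top
  element.\<close>

lemma end_homogeneous_extend:
  fixes c :: "'a::linorder set \<Rightarrow> nat" and q r m j :: nat
  assumes q: "q \<ge> 2" and c: "\<And>S. c S < q"
    and "finite B" "finite R" "card B + j = m" "card R \<ge> q ^ (j * m ^ r)"
    and "\<And>b x. b \<in> B \<Longrightarrow> x \<in> R \<Longrightarrow> b < x"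
    and "end_homogeneous c (Suc r) B (B \<union> R)"
  shows "\<exists>B' z. B \<subseteq> B' \<and> B' \<subseteq> B \<union> R \<and> card B' = m \<and> z \<in> R \<and> (\<forall>b\<in>B'. b < z) \<and>
           end_homogeneous c (Suc r) B' (insert z B')"
  using assms(3-)
proof (induction j arbitrary: B R)
  case 0
  then have "R \<noteq> {}" by auto
  then obtain z where "z \<in> R" by blast
  moreover from this have "end_homogeneous c (Suc r) B (insert z B)"
    using 0 unfolding end_homogeneous_def by blast
  ultimately show ?case using 0 by (intro exI[of _ B] exI[of _ z]) auto
next
  case (Suc j)
  define v where "v = Min R"
  have "R \<noteq> {}" using Suc.prems(4) q by auto
  then have v: "v \<in> R" "\<And>x. x \<in> R - {v} \<Longrightarrow> v < x"
    using Suc.prems(2) unfolding v_def by (auto simp: order.not_eq_order_implies_strict)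
  let ?F = "PiE (nsets B r) (\<lambda>_. {..<q})"
  let ?Q = "q ^ (m ^ r)"
  \<comment> \<open>\<open>g x\<close> records exactly the colours on which adding \<open>v\<close>
    to \<open>B\<close> imposes new conditions: those of the sets made of \<open>x\<close>,
    \<open>v\<close> and \<open>r\<close> points of \<open>B\<close>.\<close>
  define g where "g x = restrict (\<lambda>T. c (insert x (insert v T))) (nsets B r)" for x
  have fin: "finite (nsets B r)" using Suc.prems(1) by (simp add: finite_imp_finite_nsets)
  have "card (nsets B r) = card B choose r"
    by (rule card_nsets)
  also have "\<dots> \<le> card B ^ r"
    by (metis binomial_eq_0 binomial_le_pow linorder_not_le zero_le)
  also have "\<dots> \<le> m ^ r" using Suc.prems(3) by (simp add: power_mono)
  finally have cardF: "card ?F \<le> ?Q"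
    using q fin by (simp add: card_PiE power_increasing)
  have "g \<in> (R - {v}) \<rightarrow> ?F" using c by (auto simp: g_def)
  moreover have "finite ?F" "?F \<noteq> {}" using fin q by (auto simp: finite_PiE PiE_eq_empty_iff lessThan_empty_iff)
  ultimately obtain y where y: "card (R - {v}) \<le> card (g -` {y} \<inter> (R - {v})) * card ?F"
    using pigeonhole_card[of g "R - {v}" ?F] Suc.prems(2) by auto
  define R' where "R' = g -` {y} \<inter> (R - {v})"
  have "card R - 1 = card (R - {v})" using v(1) by simp
  also have "\<dots> \<le> card R' * card ?F" using y by (simp add: R'_def)
  also have "\<dots> \<le> card R' * ?Q" using cardF by (rule mult_le_mono2)
  finally have "card R - 1 \<le> card R' * ?Q" .
  \<comment> \<open>The summand 1 pays for the removal of \<open>v\<close>; integrality absorbs it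
    below because \<open>?Q > 1\<close>.\<close>
  then have "?Q * q ^ (j * m ^ r) \<le> card R' * ?Q + 1"
    using Suc.prems(4) by (simp add: power_add)
  moreover have "?Q > 1"
  proof -
    have "m > 0" using Suc.prems(3) by simp
    then show ?thesis using q by (intro one_less_power) auto
  qed
  ultimately have cR': "q ^ (j * m ^ r) \<le> card R'"
  proof -
    assume a: "?Q * q ^ (j * m ^ r) \<le> card R' * ?Q + 1" "?Q > 1"
    show ?thesis
    proof (rule ccontr)
      assume "\<not> ?thesis"
      then have "?Q * (card R' + 1) \<le> ?Q * q ^ (j * m ^ r)" by (intro mult_le_mono2) simp
      with a show False by (simp add: algebra_simps)
    qed
  qed
  have R'R: "R' \<subseteq> R - {v}" by (auto simp: R'_def)
  have vB: "v \<notin> B" using Suc.prems(5) v(1) by blast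
  have "\<exists>B' z. insert v B \<subseteq> B' \<and> B' \<subseteq> insert v B \<union> R' \<and> card B' = m \<and> z \<in> R' \<and> (\<forall>b\<in>B'. b < z) \<and>
           end_homogeneous c (Suc r) B' (insert z B')"
  proof (rule Suc.IH)
    show "finite (insert v B)" "finite R'" using Suc.prems(1,2) R'R by (auto intro: finite_subset)
    show "card (insert v B) + j = m" using Suc.prems(1,3) vB by simp
    show "q ^ (j * m ^ r) \<le> card R'" by (rule cR')
    show "b < x" if "b \<in> insert v B" "x \<in> R'" for b x
      using that v R'R Suc.prems(5) by blast
    have "c (insert x T) = c (insert y' T)"
      if T: "T \<in> nsets (insert v B) (Suc r)" and xy: "x \<in> insert v B \<union> R'" "y' \<in> insert v B \<union> R'"
      and lt: "\<forall>t\<in>T. t < x \<and> t < y'" for T x y'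
    proof (cases "v \<in> T")
      case False
      then have "T \<in> nsets B (Suc r)" using T by (auto simp: nsets_def)
      then show ?thesis using end_homogeneousD[OF Suc.prems(6)] xy lt v(1) R'R by blast
    next
      case True
      have "T - {v} \<in> nsets B r" using T True by (auto simp: nsets_def)
      \<comment> \<open>Both points exceed \<open>v\<close>, and no point of
        \<open>insert v B\<close> does; on \<open>R'\<close> the function \<open>g\<close> is
        constant.\<close>
      moreover have "x \<in> R'" "y' \<in> R'"
        using xy lt True v(1) Suc.prems(5) by (metis UnE insertE less_asym less_irrefl)+
      then have "g x = g y'" by (auto simp: R'_def)
      ultimately have "c (insert x (insert v (T - {v}))) = c (insert y' (insert v (T - {v})))"
        unfolding g_def by (metis restrict_apply')
      then show ?thesis using True by (simp add: insert_absorb)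
    qed
    then show "end_homogeneous c (Suc r) (insert v B) (insert v B \<union> R')"
      unfolding end_homogeneous_def by blast
  qed
  then obtain B' z where B': "insert v B \<subseteq> B'" "B' \<subseteq> insert v B \<union> R'" "z \<in> R'"
    and "card B' = m \<and> (\<forall>b\<in>B'. b < z) \<and>
           end_homogeneous c (Suc r) B' (insert z B')"
    by blast
  moreover have "B \<subseteq> B'" "B' \<subseteq> B \<union> R" "z \<in> R" using B' R'R v(1) by auto
  ultimately show ?case by (intro exI[of _ B'] exI[of _ z]) simp
qed

text \<open>The argument \<open>r\<close> is one less than the size of the coloured sets. Selecting
  \<open>m\<close> points greedily from scratch takes \<open>q ^ (m * m ^ r)\<close> candidates,
  whence the exponent \<open>Suc r\<close>.\<close>

fun ramsey_bound :: "nat \<Rightarrow> nat \<Rightarrow> nat \<Rightarrow> nat" where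
  "ramsey_bound q 0 k = q * k"
| "ramsey_bound q (Suc r) k = q ^ (ramsey_bound q r k ^ Suc r)"

text \<open>Erdos-Rado induction: inside an end-homogeneous set the top of every set can be replaced
  by the fixed \<open>z\<close>, so the colouring descends to sets with one element less. The base
  case is the pigeonhole principle.\<close>

lemma ramsey_bound_homogeneous:
  fixes c :: "'a::linorder set \<Rightarrow> nat" and q r k :: nat
  assumes "q \<ge> 2" and "\<And>S. c S < q" and "finite A" and "card A \<ge> ramsey_bound q r k"
  shows "\<exists>H i. H \<subseteq> A \<and> card H = k \<and> (\<forall>S\<in>nsets H (Suc r). c S = i)"
  using assms(2-)
proof (induction r arbitrary: c A)
  case 0
  have "(\<lambda>x. c {x}) \<in> A \<rightarrow> {..<q}" using 0 by auto
  moreover have "{..<q} \<noteq> {}" using assms(1) by (auto simp: lessThan_empty_iff)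
  ultimately obtain i where "card A \<le> card ((\<lambda>x. c {x}) -` {i} \<inter> A) * q"
    using pigeonhole_card[of "\<lambda>x. c {x}" A "{..<q}"] 0 by auto
  moreover have "k * q \<le> card A" using 0 by (simp add: mult.commute)
  ultimately have "k * q \<le> card ((\<lambda>x. c {x}) -` {i} \<inter> A) * q" by linarith
  then have "k \<le> card ((\<lambda>x. c {x}) -` {i} \<inter> A)" using assms(1) by simp
  then obtain H where "H \<subseteq> (\<lambda>x. c {x}) -` {i} \<inter> A" "card H = k"
    using obtain_subset_with_card_n by metis
  then show ?case by (intro exI[of _ H] exI[of _ i]) (auto simp: nsets_one)
next
  case (Suc r)
  let ?m = "ramsey_bound q r k"
  obtain B z where B: "B \<subseteq> A" "card B = ?m" "z \<in> A" "\<forall>b\<in>B. b < z"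
    and hom: "end_homogeneous c (Suc r) B (insert z B)"
    using end_homogeneous_extend[of q c "{}" A ?m ?m r] Suc.prems assms(1)
    by (auto simp: end_homogeneous_def nsets_empty_iff)
  obtain H i where H: "H \<subseteq> B" "card H = k" "\<forall>T\<in>nsets H (Suc r). c (insert z T) = i"
    using Suc.IH[of "\<lambda>T. c (insert z T)" B] Suc.prems B by (metis finite_subset order_refl)
  have "\<forall>S\<in>nsets H (Suc (Suc r)). c S = i"
  proof
    fix S assume S: "S \<in> nsets H (Suc (Suc r))"
    have fin: "finite S" "S \<noteq> {}" using S by (auto simp: nsets_def)
    let ?x = "Max S" and ?T = "S - {Max S}"
    have T: "?T \<in> nsets H (Suc r)" using S fin by (auto simp: nsets_def)
    have x: "?x \<in> S" "\<forall>t\<in>?T. t < ?x" using fin by (auto simp: order.not_eq_order_implies_strict)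
    have "S \<subseteq> B" using S H by (auto simp: nsets_def)
    then have "c (insert ?x ?T) = c (insert z ?T)"
      using x B(4) by (intro end_homogeneousD[OF hom subsetD[OF nsets_mono[OF H(1)] T]]) auto
    also have "\<dots> = i" using H T by blast
    finally show "c S = i" using x by (simp add: insert_absorb)
  qed
  moreover have "H \<subseteq> A" using H(1) B(1) by (rule subset_trans)
  ultimately show ?case using H(2) by (intro exI[of _ H] exI[of _ i] conjI)
qed

section \<open>Orientation of point triples\<close>

text \<open>Twice the signed area of the triangle, positive exactly for counterclockwise
  triples.\<close>

definition orient :: "real^2 \<Rightarrow> real^2 \<Rightarrow> real^2 \<Rightarrow> real" where
  "orient p q r = (q$1 - p$1) * (r$2 - p$2) - (q$2 - p$2) * (r$1 - p$1)"

lemma orient_degenerate [simp]: "orient p q p = 0" "orient p q q = 0"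
  by (simp_all add: orient_def)

lemma orient_swap: "orient p r q = - orient p q r"
  by (simp add: orient_def algebra_simps)

lemma orient_affine:
  "orient p q ((1 - u) *\<^sub>R x + u *\<^sub>R y) = (1 - u) * orient p q x + u * orient p q y"
  by (simp add: orient_def algebra_simps)

lemma orient_eq_0_imp_collinear:
  assumes "orient p q r = 0"
  shows "collinear {p, q, r}"
proof (cases "p = q")
  case False
  let ?u = "q - p"
  \<comment> \<open>The ratio is read off in a coordinate in which \<open>p\<close> and
    \<open>q\<close> differ.\<close>
  define c where "c = (if q$1 \<noteq> p$1 then (r$1 - p$1) / (q$1 - p$1) else (r$2 - p$2) / (q$2 - p$2))"
  have "q$1 \<noteq> p$1 \<or> q$2 \<noteq> p$2" using False by (auto simp: vec_eq_iff forall_2)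
  then have "r - p = c *\<^sub>R ?u"
    using assms by (auto simp: vec_eq_iff forall_2 c_def orient_def field_simps)
  then have "collinear {0, q - p, r - p}" by (auto simp: collinear_lemma)
  then show ?thesis using collinear_3[of q p r] by (simp add: insert_commute)
qed simp

lemma orient_nonzero_if_general_position:
  assumes "general_position P" "{p, q, r} \<subseteq> P" "card {p, q, r} = 3"
  shows "orient p q r \<noteq> 0"
proof
  have "{p, q, r} \<in> nsets P 3" using assms(2,3) unfolding nsets_def by blast
  moreover assume "orient p q r = 0"
  then have "collinear {p, q, r}" by (rule orient_eq_0_imp_collinear)
  ultimately show False using assms(1) unfolding general_position_def by blast
qed

text \<open>Orientation is affine in its third argument and an interior point has two positive
  weights, so strictness at one endpoint suffices.\<close>

lemma orient_on_open_segment_pos: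
  assumes "z \<in> open_segment x y" "s * orient p q x \<ge> 0" "s * orient p q y \<ge> 0"
    and "s * orient p q x > 0 \<or> s * orient p q y > 0"
  shows "s * orient p q z > (0::real)"
proof -
  obtain u where u: "0 < u" "u < 1" "z = (1 - u) *\<^sub>R x + u *\<^sub>R y"
    using assms(1) by (auto simp: in_segment)
  have "s * orient p q z = (1 - u) * (s * orient p q x) + u * (s * orient p q y)"
    unfolding u(3) orient_affine by (simp add: algebra_simps)
  also have "\<dots> > 0"
    using assms(2-4) u by (metis add_nonneg_pos add_pos_nonneg diff_gt_0_iff_gt less_imp_le
        mult_nonneg_nonneg mult_pos_pos)
  finally show ?thesis .
qed

lemma orient_on_open_segment_0:
  assumes "z \<in> open_segment p q"
  shows "orient p q z = 0"
proof -
  obtain u where "z = (1 - u) *\<^sub>R p + u *\<^sub>R q"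
    using assms by (auto simp: in_segment)
  then show ?thesis by (simp only: orient_affine) simp
qed

text \<open>For chords \<open>a < b\<close> and \<open>c < d\<close> of a convex polygon numbered
  cyclically, this rules out interleaved endpoints. The weak inequalities admit shared
  endpoints.\<close>

definition nested_or_disjoint :: "nat \<Rightarrow> nat \<Rightarrow> nat \<Rightarrow> nat \<Rightarrow> bool" where
  "nested_or_disjoint a b c d \<longleftrightarrow> b \<le> c \<or> d \<le> a \<or> (a \<le> c \<and> d \<le> b) \<or> (c \<le> a \<and> b \<le> d)"

text \<open>The sign \<open>s\<close> treats both orientations at once.  The hypothesis says that \<open>g\<close> runs through a
  convex polygon in cyclic order; no sorting of the points by coordinates is needed.\<close>
lemma open_segments_disjoint:
  fixes g :: "nat \<Rightarrow> real^2" and s :: real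
  assumes ori: "\<And>i j l. i < j \<Longrightarrow> j < l \<Longrightarrow> l < k \<Longrightarrow> s * orient (g i) (g j) (g l) > 0"
    and "a < b" "b < k" "c < d" "d < k" "(a, b) \<noteq> (c, d)" "nested_or_disjoint a b c d"
  shows "open_segment (g a) (g b) \<inter> open_segment (g c) (g d) = {}"
proof -
  \<comment> \<open>Relative to the line through two vertices, later vertices lie on the side given
    by \<open>s\<close> and intermediate ones on the opposite side.\<close>
  have outside: "s * orient (g a) (g b) (g c) > 0" if "a < b" "b < c" "c < k" for a b c
    using ori that by blast
  have inside: "- s * orient (g a) (g b) (g c) > 0" if "a < c" "c < b" "b < k" for a b c
    using ori[of a c b] that by (simp add: orient_swap[of "g a" "g b"])
  \<comment> \<open>The line through \<open>g a\<close> and \<open>g b\<close> separates: the other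
    segment is strictly on one side of it, even if \<open>b = c\<close> puts one endpoint on the
    line.\<close>
  have right: "open_segment (g a) (g b) \<inter> open_segment (g c) (g d) = {}"
    if "a < b" "b \<le> c" "c < d" "d < k" for a b c d
  proof -
    have "s * orient (g a) (g b) (g c) \<ge> 0" 
      using outside[of a b c] that by (cases "b = c") auto
    moreover have "s * orient (g a) (g b) (g d) > 0" using outside that by auto
    ultimately show ?thesis
      using orient_on_open_segment_pos[of _ "g c" "g d" s "g a" "g b"]
        orient_on_open_segment_0[of _ "g a" "g b"] by fastforce
  qed
  \<comment> \<open>Since the pairs differ, at most one endpoint of the inner chord lies on the line
    of the outer chord.\<close>
  have within: "open_segment (g a) (g b) \<inter> open_segment (g c) (g d) = {}"
    if "a \<le> c" "c < d" "d \<le> b" "b < k" "(a, b) \<noteq> (c, d)" for a b c d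
  proof -
    have "- s * orient (g a) (g b) (g c) > 0 \<or> c = a" "- s * orient (g a) (g b) (g d) > 0 \<or> d = b"
      using inside[of a c b] inside[of a d b] that by linarith+
    then show ?thesis
      using that orient_on_open_segment_pos[of _ "g c" "g d" "- s" "g a" "g b"]
        orient_on_open_segment_0[of _ "g a" "g b"] by fastforce
  qed
  \<comment> \<open>The remaining cases arise by exchanging the two chords.\<close>
  show ?thesis
    using assms(2-) right[of a b c d] right[of c d a b] within[of a c d b] within[of c a b d]
    unfolding nested_or_disjoint_def by (auto simp: Int_commute)
qed

section \<open>The preorder-labelled complete binary tree\<close>

text \<open>A left subtree of height \<open>h\<close> has \<open>2 ^ h - 1\<close> vertices and
  takes the labels from \<open>s + 1\<close> on, so the right subtree starts at
  \<open>s + 2 ^ h\<close>.\<close>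

fun preorder_tree :: "nat \<Rightarrow> nat \<Rightarrow> nat tree" where
  "preorder_tree s 0 = Leaf"
| "preorder_tree s (Suc h) = Node (preorder_tree (s + 1) h) s (preorder_tree (s + 2 ^ h) h)"

lemma height_preorder_tree [simp]: "height (preorder_tree s h) = h"
  by (induction h arbitrary: s) auto

lemma complete_preorder_tree: "Tree.complete (preorder_tree s h)"
  by (induction h arbitrary: s) auto

lemma size_preorder_tree: "size (preorder_tree s h) = 2 ^ h - 1"
  using size_if_complete[OF complete_preorder_tree] by simp

lemma set_preorder_tree: "set_tree (preorder_tree s h) = {s..<s + 2 ^ h - 1}"
proof (induction h arbitrary: s)
  case (Suc h)
  obtain N :: nat where "2 ^ h = Suc N"
    by (metis not0_implies_Suc power_not_zero zero_neq_numeral)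
  then show ?case by (auto simp: Suc)
qed simp

lemma distinct_preorder_tree: "distinct (inorder (preorder_tree s h))"
  by (induction h arbitrary: s) (auto simp: set_preorder_tree)

lemma root_edge_preorder_tree:
  "root_edge v (preorder_tree s h) = (if h = 0 then {} else {{v, s}})"
  by (cases h) auto

lemma tree_edges_preorder_tree_range:
  assumes "e \<in> tree_edges (preorder_tree s h)"
  shows "\<exists>a b. e = {a, b} \<and> s \<le> a \<and> a < b \<and> b < s + 2 ^ h - 1"
  using assms
proof (induction h arbitrary: s)
  case (Suc h)
  \<comment> \<open>With \<open>h > 0\<close> the right child's label \<open>s + 2 ^ h\<close> stays
    below the end of the label range.\<close>
  have h: "h > 0 \<Longrightarrow> (2::nat) \<le> 2 ^ h" using self_le_power[of 2 h] by simp
  from Suc.prems consider "h > 0" "e = {s, s + 1}" | "h > 0" "e = {s, s + 2 ^ h}"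
    | "e \<in> tree_edges (preorder_tree (s + 1) h)" | "e \<in> tree_edges (preorder_tree (s + 2 ^ h) h)"
    by (auto simp: root_edge_preorder_tree split: if_splits)
  then show ?case
  proof cases
    case 1
    then show ?thesis using h by (intro exI[of _ s] exI[of _ "s + 1"]) auto
  next
    case 2
    then show ?thesis using h by (intro exI[of _ s] exI[of _ "s + 2 ^ h"]) auto
  next
    case 3
    from Suc.IH[OF this] obtain a b where "e = {a, b}" "s + 1 \<le> a" "a < b" "b < s + 1 + 2 ^ h - 1"
      by blast
    then show ?thesis by (intro exI[of _ a] exI[of _ b]) auto
  next
    case 4
    from Suc.IH[OF this] obtain a b where "e = {a, b}" "s + 2 ^ h \<le> a" "a < b" "b < s + 2 ^ h + 2 ^ h - 1"
      by blast
    then show ?thesis by (intro exI[of _ a] exI[of _ b]) auto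
  qed
qed simp

text \<open>The two subtrees occupy consecutive blocks of labels. Both root edges start below these
  blocks: the one to \<open>s + 1\<close> ends where the left block begins, and the one to
  \<open>s + 2 ^ h\<close> spans the left block and ends where the right one begins.\<close>

lemma tree_edges_preorder_tree_laminar:
  assumes "{a, b} \<in> tree_edges (preorder_tree s h)" "{c, d} \<in> tree_edges (preorder_tree s h)"
    and "a < b" "c < d"
  shows "nested_or_disjoint a b c d"
  using assms
proof (induction h arbitrary: s)
  case (Suc h)
  define L where "L = tree_edges (preorder_tree (s + 1) h)"
  define R where "R = tree_edges (preorder_tree (s + 2 ^ h) h)"
  have L: "s + 1 \<le> x \<and> y < s + 2 ^ h" if "{x, y} \<in> L" "x < y" for x y
    using tree_edges_preorder_tree_range[of "{x, y}" "s + 1" h] that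
    by (auto simp: L_def doubleton_eq_iff)
  have R: "s + 2 ^ h \<le> x" if "{x, y} \<in> R" "x < y" for x y
    using tree_edges_preorder_tree_range[of "{x, y}" "s + 2 ^ h" h] that
    by (auto simp: R_def doubleton_eq_iff)
  have split: "x = s \<and> y = s + 1 \<or> x = s \<and> y = s + 2 ^ h \<or> {x, y} \<in> L \<or> {x, y} \<in> R"
    if "{x, y} \<in> tree_edges (preorder_tree s (Suc h))" "x < y" for x y
    using that by (auto simp: root_edge_preorder_tree doubleton_eq_iff L_def R_def split: if_splits)
  have "nested_or_disjoint a b c d" if "{a, b} \<in> L" "{c, d} \<in> L"
    using Suc.IH that Suc.prems(3,4) by (simp add: L_def)
  moreover have "nested_or_disjoint a b c d" if "{a, b} \<in> R" "{c, d} \<in> R"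
    using Suc.IH that Suc.prems(3,4) by (simp add: R_def)
  moreover have "(1::nat) \<le> 2 ^ h" by simp
  ultimately show ?case
    using split[OF Suc.prems(1,3)] split[OF Suc.prems(2,4)] Suc.prems(3,4)
      L[of a b] L[of c d] R[of a b] R[of c d]
    unfolding nested_or_disjoint_def by linarith
qed simp

lemma root_leaf_paths_subset: "p \<in> root_leaf_paths t \<Longrightarrow> set p \<subseteq> set_tree t"
  by (induction t arbitrary: p) (fastforce split: if_splits)+

text \<open>In preorder every label exceeds those of its ancestors.\<close>

lemma root_leaf_paths_preorder_tree_sorted:
  "p \<in> root_leaf_paths (preorder_tree s h) \<Longrightarrow> sorted_wrt (<) p"
proof (induction h arbitrary: s p)
  case (Suc h)
  have "\<forall>p\<in>root_leaf_paths (preorder_tree s' h). \<forall>x\<in>set p. s < x" if "s < s'" for s'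
    using that root_leaf_paths_subset[of _ "preorder_tree s' h"] by (fastforce simp: set_preorder_tree)
  from this[of "s + 1"] this[of "s + 2 ^ h"] show ?case using Suc by (auto split: if_splits)
qed simp

section \<open>Relabelling trees\<close>

lemma root_edge_map_tree: "root_edge (f v) (map_tree f t) = (`) f ` root_edge v t"
  by (cases t) auto

lemma tree_edges_map_tree: "tree_edges (map_tree f t) = (`) f ` tree_edges t"
  by (induction t) (auto simp: root_edge_map_tree image_Un)

lemma root_leaf_paths_map_tree: "root_leaf_paths (map_tree f t) = map f ` root_leaf_paths t"
  by (induction t) (auto simp: image_Un image_image)

lemma complete_map_tree: "Tree.complete (map_tree f t) \<longleftrightarrow> Tree.complete t"
  by (induction t) auto

section \<open>Monotone trees in drawings of complete graphs\<close>

text \<open>Relabelling the preorder tree by \<open>g\<close> works: laminar labels in convex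
  position give no crossings, and sorted labels make \<open>mono\<close> apply to any two
  consecutive edges of a path.\<close>

lemma homogeneous_drawing_tree:
  fixes g :: "nat \<Rightarrow> real^2" and s :: real and k h :: nat
  assumes inj: "inj_on g {..<k}" and g: "g ` {..<k} \<subseteq> P" and k: "k = 2 ^ h - 1" "h > 0"
    and lin: "linear_order_on (nsets P 2) r"
    and ori: "\<And>i j l. i < j \<Longrightarrow> j < l \<Longrightarrow> l < k \<Longrightarrow> s * orient (g i) (g j) (g l) > 0"
    and mono: "\<And>i j l. i < j \<Longrightarrow> j < l \<Longrightarrow> l < k \<Longrightarrow>
      ({g i, g j}, {g j, g l}) \<in> r \<longleftrightarrow> b"
  shows "\<exists>t. binary_tree_in t (P, nsets P 2) \<and> non_crossing (tree_edges t) \<and>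
           monotone_tree r t \<and> size t = k"
proof -
  let ?T = "preorder_tree 0 h"
  let ?t = "map_tree g ?T"
  have set: "set_tree ?T = {..<k}" by (auto simp: set_preorder_tree k)
  have edges: "\<exists>x y. e = {g x, g y} \<and> {x, y} \<in> tree_edges ?T \<and> x < y \<and> y < k"
    if "e \<in> tree_edges ?t" for e
    using that tree_edges_preorder_tree_range[of _ 0 h]
    by (fastforce simp: tree_edges_map_tree k)
  have "binary_tree_in ?t (P, nsets P 2)"
    unfolding binary_tree_in_def
  proof (intro conjI)
    show "?t \<noteq> Leaf" using k(2) by (cases h) auto
    show "Tree.complete ?t" by (simp add: complete_map_tree complete_preorder_tree)
    show "distinct (inorder ?t)"
      using inj set distinct_preorder_tree[of 0 h]
      by (simp add: inorder_map distinct_map)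
    show "set_tree ?t \<subseteq> verts (P, nsets P 2)" using g set by (simp add: tree.set_map)
    show "tree_edges ?t \<subseteq> edges (P, nsets P 2)"
    proof
      fix e assume "e \<in> tree_edges ?t"
      then obtain x y where "e = {g x, g y}" "x < y" "y < k" using edges by blast
      then show "e \<in> edges (P, nsets P 2)"
        using g inj by (auto simp: nsets_def inj_on_def card_insert_if)
    qed
  qed
  moreover have "non_crossing (tree_edges ?t)"
    unfolding non_crossing_def edges_cross_def
  proof (intro ballI notI, elim conjE exE)
    fix e f p q p' q'
    assume e: "e \<in> tree_edges ?t" and f: "f \<in> tree_edges ?t" and "e \<noteq> f"
      and pq: "e = {p, q}" "f = {p', q'}" and ne: "open_segment p q \<inter> open_segment p' q' \<noteq> {}"
    obtain x y where xy: "e = {g x, g y}" "{x, y} \<in> tree_edges ?T" "x < y" "y < k"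
      using edges[OF e] by blast
    obtain z w where zw: "f = {g z, g w}" "{z, w} \<in> tree_edges ?T" "z < w" "w < k"
      using edges[OF f] by blast
    have "open_segment (g x) (g y) \<inter> open_segment (g z) (g w) = {}"
      using ori xy zw \<open>e \<noteq> f\<close>
      by (intro open_segments_disjoint[of k s g] tree_edges_preorder_tree_laminar[of _ _ 0 h]) auto
    moreover have "open_segment p q = open_segment (g x) (g y)"
      "open_segment p' q' = open_segment (g z) (g w)"
      using pq xy(1) zw(1) by (auto simp: doubleton_eq_iff open_segment_commute)
    ultimately show False using ne by metis
  qed
  moreover have "monotone_tree r ?t"
  proof -
    \<comment> \<open>If \<open>b\<close> is false, totality of \<open>r\<close> turns the failed
      comparison into the strict reverse one.\<close>
    have strict: "(e, f) \<in> (if b then r - Id else (r - Id)\<inverse>)"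
      if "e \<in> nsets P 2" "f \<in> nsets P 2" "e \<noteq> f" "(e, f) \<in> r \<longleftrightarrow> b" for e f
      using lin that unfolding linear_order_on_def total_on_def by auto
    have path: "({p ! i, p ! (i+1)}, {p ! (i+1), p ! (i+2)}) \<in> (if b then r - Id else (r - Id)\<inverse>)"
      if p: "p \<in> root_leaf_paths ?t" and i: "i + 2 < length p" for p i
    proof -
      obtain p' where p': "p' \<in> root_leaf_paths ?T" "p = map g p'"
        using p by (auto simp: root_leaf_paths_map_tree)
      let ?x = "p' ! i" and ?y = "p' ! (i+1)" and ?z = "p' ! (i+2)"
      have len: "i + 2 < length p'" using i p' by simp
      have "sorted_wrt (<) p'" using p'(1) root_leaf_paths_preorder_tree_sorted by blast
      then have lt: "?x < ?y" "?y < ?z" using len by (auto simp: sorted_wrt_iff_nth_less)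
      have "?z < k" using root_leaf_paths_subset[OF p'(1)] set nth_mem[OF len] by blast
      have "g ?x \<noteq> g ?y" "g ?y \<noteq> g ?z" "g ?x \<noteq> g ?z"
        using inj_on_eq_iff[OF inj] lt \<open>?z < k\<close> by auto
      moreover have "g ?x \<in> P" "g ?y \<in> P" "g ?z \<in> P" using g lt \<open>?z < k\<close> by auto
      ultimately have *: "{g ?x, g ?y} \<in> nsets P 2" "{g ?y, g ?z} \<in> nsets P 2"
        "{g ?x, g ?y} \<noteq> {g ?y, g ?z}"
        by (auto simp: nsets_def doubleton_eq_iff)
      have "({g ?x, g ?y}, {g ?y, g ?z}) \<in> (if b then r - Id else (r - Id)\<inverse>)"
        by (rule strict[OF * mono[OF lt \<open>?z < k\<close>]])
      then show ?thesis using p' len by simp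
    qed
    show ?thesis
    \<comment> \<open>If \<open>b\<close> holds, edges grow along each path, which is the decreasing
      case in the convention used here.\<close>
    proof (cases b)
      case True
      then show ?thesis using path unfolding monotone_tree_def decreasing_path_def by auto
    next
      case False
      then show ?thesis using path unfolding monotone_tree_def increasing_path_def by auto
    qed
  qed
  moreover have "size ?t = k" by (simp add: size_preorder_tree k)
  ultimately show ?thesis by blast
qed

lemma large_drawing_tree:
  fixes P :: "(real^2) set"
  assumes P: "finite P" "general_position P" and n: "card P \<ge> 4 ^ 4 ^ (8 * (2 ^ h - 1))" and "h > 0"
    and lin: "linear_order_on (nsets P 2) r"
  shows "\<exists>t. binary_tree_in t (P, nsets P 2) \<and> non_crossing (tree_edges t) \<and>
           monotone_tree r t \<and> size t = 2 ^ h - 1"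
proof -
  define k :: nat where "k = 2 ^ h - 1"
  obtain f where f: "bij_betw f {..<card P} P"
    using ex_bij_betw_nat_finite[OF P(1)] by (auto simp: atLeast0LessThan)
  define ccw where "ccw i j l \<longleftrightarrow> orient (f i) (f j) (f l) > 0" for i j l
  define le where "le i j l \<longleftrightarrow> ({f i, f j}, {f j, f l}) \<in> r" for i j l
  \<comment> \<open>The low bit stores orientation and the high bit the edge comparison. On sets
    with fewer than three elements the list access is unspecified, but the value stays below
    4.\<close>
  define c where "c S = (let xs = sorted_list_of_set S in
    (if ccw (xs ! 0) (xs ! 1) (xs ! 2) then 1 else 0) +
    (if le (xs ! 0) (xs ! 1) (xs ! 2) then 2 else (0::nat)))" for S
  \<comment> \<open>The recursion gives \<open>4 * k\<close>, then \<open>4 ^ (4 * k)\<close>;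
    squaring the latter in the last exponent doubles \<open>4 * k\<close> to
    \<open>8 * k\<close>.\<close>
  have "ramsey_bound 4 2 k = 4 ^ 4 ^ (8 * k)"
    by (simp add: numeral_2_eq_2 power_add[symmetric] power_mult[symmetric])
  then have "card {..<card P} \<ge> ramsey_bound 4 2 k" using n by (simp add: k_def)
  moreover have "c S < 4" for S by (simp add: c_def Let_def)
  ultimately obtain H m where H: "H \<subseteq> {..<card P}" "card H = k" "\<forall>S\<in>nsets H 3. c S = m"
    using ramsey_bound_homogeneous[of 4 c "{..<card P}" 2 k] by auto
  have finH: "finite H" using H finite_subset by blast
  define g where "g i = sorted_list_of_set H ! i" for i
  have g_less: "g i < g j" if "i < j" "j < k" for i j
    using that H finH sorted_wrt_nth_less[OF strict_sorted_list_of_set[of H]] by (simp add: g_def)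
  have g_mem: "g i \<in> H" if "i < k" for i
    using that H finH nth_mem[of i "sorted_list_of_set H"] by (simp add: g_def)
  have c_g: "(if ccw (g i) (g j) (g l) then 1 else 0) + (if le (g i) (g j) (g l) then 2 else 0) = m"
    if "i < j" "j < l" "l < k" for i j l
  proof -
    have lt: "g i < g j" "g j < g l" "g i < g l" using g_less that by auto
    then have "{g i, g j, g l} \<in> nsets H 3" using g_mem that by (auto simp: nsets_def)
    moreover have "sorted_list_of_set {g i, g j, g l} = [g i, g j, g l]"
      using lt by (auto simp: insert_Diff_if)
    ultimately show ?thesis using H(3) by (force simp: c_def)
  qed
  have "inj_on g {..<k}" using g_less by (intro linorder_inj_onI) (auto, metis less_irrefl)
  moreover have gH: "g ` {..<k} \<subseteq> {..<card P}" using g_mem H(1) by auto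
  ultimately have inj: "inj_on (f \<circ> g) {..<k}"
    using f by (meson bij_betw_imp_inj_on comp_inj_on inj_on_subset)
  have fgP: "(f \<circ> g) ` {..<k} \<subseteq> P"
    using gH f unfolding bij_betw_def by auto
  \<comment> \<open>Odd colours are the counterclockwise ones; for even colours general position
    excludes orientation 0 and leaves the negative sign.\<close>
  let ?s = "if odd m then 1 else -1 :: real"
  have "\<exists>t. binary_tree_in t (P, nsets P 2) \<and> non_crossing (tree_edges t) \<and>
           monotone_tree r t \<and> size t = k"
  proof (rule homogeneous_drawing_tree[of "f \<circ> g" k P h r ?s "m \<ge> 2"])
    show "inj_on (f \<circ> g) {..<k}" by (rule inj)
    show "(f \<circ> g) ` {..<k} \<subseteq> P" by (rule fgP)
  next
    fix i j l assume ijl: "i < j" "j < l" "l < k"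
    have "f (g i) \<noteq> f (g j)" "f (g j) \<noteq> f (g l)" "f (g i) \<noteq> f (g l)"
      using inj_on_eq_iff[OF inj, of i j] inj_on_eq_iff[OF inj, of j l]
        inj_on_eq_iff[OF inj, of i l] ijl by auto
    moreover have "{f (g i), f (g j), f (g l)} \<subseteq> P" using fgP ijl by auto
    ultimately have "orient (f (g i)) (f (g j)) (f (g l)) \<noteq> 0"
      using P(2) by (intro orient_nonzero_if_general_position[of P]) auto
    then show "?s * orient ((f \<circ> g) i) ((f \<circ> g) j) ((f \<circ> g) l) > 0"
      using c_g[OF ijl] by (auto simp: ccw_def split: if_splits)
    show "({(f \<circ> g) i, (f \<circ> g) j}, {(f \<circ> g) j, (f \<circ> g) l}) \<in> r \<longleftrightarrow> m \<ge> 2"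
      using c_g[OF ijl] by (auto simp: le_def split: if_splits)
  qed (use assms in \<open>auto simp: k_def\<close>)
  then show ?thesis by (simp add: k_def)
qed

section \<open>Drawings of complete graphs and the minima defining the parameter\<close>

lemma drawing_complete_simple_graph:
  assumes "straight_line_drawing D (complete_simple_graph n)"
  shows "D = (verts D, nsets (verts D) 2)" "finite (verts D)" "card (verts D) = n"
    "general_position (verts D)"
proof -
  obtain f where f: "bij_betw f {..<n} (verts D)" "edges D = (`) f ` nsets {..<n} 2"
    using assms by (auto simp: straight_line_drawing_def graph_isomorphic_def complete_simple_graph_def)
  show "D = (verts D, nsets (verts D) 2)"
    using bij_betw_nsets[OF f(1), of 2] f(2) by (simp add: bij_betw_def prod_eq_iff)
  show "finite (verts D)" "card (verts D) = n"
    using bij_betw_finite[OF f(1)] bij_betw_same_card[OF f(1)] by auto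
  show "general_position (verts D)"
    using assms by (simp add: straight_line_drawing_def geometric_graph_def)
qed

text \<open>Points on a parabola are in general position. This makes the infimum in
  \<open>tau_bar\<close> range over a nonempty set.\<close>

lemma complete_simple_graph_has_drawing:
  "\<exists>D. straight_line_drawing D (complete_simple_graph n)"
proof -
  define f :: "nat \<Rightarrow> real^2" where "f i = vector [real i, (real i)\<^sup>2]" for i
  have inj: "inj_on f A" for A by (auto simp: inj_on_def f_def vec_eq_iff forall_2)
  let ?P = "f ` {..<n}"
  have "\<not> collinear T" if T: "T \<in> nsets ?P 3" for T
  proof
    assume col: "collinear T"
    obtain i j l where ijl: "T = {f i, f j, f l}" "i \<noteq> j" "j \<noteq> l" "i \<noteq> l"
      using T unfolding nsets_def by (auto simp: card_3_iff) blast
    obtain u where u: "\<And>x y. x \<in> T \<Longrightarrow> y \<in> T \<Longrightarrow> \<exists>c. x - y = c *\<^sub>R u"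
      using col by (auto simp: collinear_def)
    obtain c where c: "f j - f i = c *\<^sub>R u" using u[of "f j" "f i"] ijl(1) by auto
    obtain d where d: "f l - f i = d *\<^sub>R u" using u[of "f l" "f i"] ijl(1) by auto
    then have cd: "real j - real i = c * u$1" "(real j)\<^sup>2 - (real i)\<^sup>2 = c * u$2"
      "real l - real i = d * u$1" "(real l)\<^sup>2 - (real i)\<^sup>2 = d * u$2"
      using c d by (auto simp: f_def vec_eq_iff forall_2)
    have "(real j - real i) * ((real l)\<^sup>2 - (real i)\<^sup>2) = (real l - real i) * ((real j)\<^sup>2 - (real i)\<^sup>2)"
      unfolding cd by simp
    \<comment> \<open>The difference of the two sides is the Vandermonde product.\<close>
    then have "(real j - real i) * (real l - real i) * (real l - real j) = 0"
      by (simp add: power2_eq_square algebra_simps)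
    then show False using ijl by simp
  qed
  then have "geometric_graph (?P, nsets ?P 2)"
    by (simp add: geometric_graph_def fin_simple_graph_def general_position_def)
  moreover have "graph_isomorphic (complete_simple_graph n) (?P, nsets ?P 2)"
    unfolding graph_isomorphic_def complete_simple_graph_def
    using bij_betw_nsets[of f "{..<n}" ?P 2] inj
    by (intro exI[of _ f]) (auto simp: bij_betw_def)
  ultimately show ?thesis by (auto simp: straight_line_drawing_def)
qed

lemma tau_bar_complete_ge:
  assumes n: "n \<ge> 4 ^ 4 ^ (8 * (2 ^ h - 1))" and "h > 0"
  shows "tau_bar (complete_simple_graph n) \<ge> 2 ^ h - 1"
proof -
  have max: "max_tree_size D r \<ge> 2 ^ h - 1"
    if D: "straight_line_drawing D (complete_simple_graph n)" and r: "edge_ordering D r" for D r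
  proof -
    note D' = drawing_complete_simple_graph[OF D]
    have edges: "edges D = nsets (verts D) 2" using D'(1) by (metis snd_conv)
    obtain t where t: "binary_tree_in t D" "non_crossing (tree_edges t)" "monotone_tree r t"
      "size t = 2 ^ h - 1"
      using large_drawing_tree[OF D'(2,4)] n D'(1,3) \<open>h > 0\<close> r
      unfolding edge_ordering_def edges by metis
    let ?S = "{size t | t. binary_tree_in t D \<and> non_crossing (tree_edges t) \<and> monotone_tree r t}"
    \<comment> \<open>Distinct labels bound the size of a tree, so \<open>Max\<close> is taken over
      a finite set.\<close>
    have "size t \<le> card (verts D)" if "binary_tree_in t D" for t
      using that D'(2) unfolding binary_tree_in_def
      by (metis card_mono distinct_card length_inorder set_inorder)
    then have "finite ?S" by (intro finite_subset[of ?S "{..card (verts D)}"]) auto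
    moreover have "2 ^ h - 1 \<in> ?S" using t by (auto intro!: exI[of _ t])
    ultimately show ?thesis unfolding max_tree_size_def by (rule Max_ge)
  qed
  have geom: "tau_bar_geom D \<ge> 2 ^ h - 1" if D: "straight_line_drawing D (complete_simple_graph n)" for D
  proof -
    \<comment> \<open>The well-ordering theorem supplies an edge-ordering, so the infimum over
      orderings is not empty.\<close>
    obtain r where "edge_ordering D r"
      using well_order_on[of "edges D"] by (auto simp: edge_ordering_def well_order_on_def)
    then show ?thesis unfolding tau_bar_geom_def using max[OF D] by (intro cInf_greatest) auto
  qed
  show ?thesis
    unfolding tau_bar_def using complete_simple_graph_has_drawing[of n] geom
    by (intro cInf_greatest) auto
qed

section \<open>Asymptotics\<close>

lemma tau_bar_complete_bigomega_lnln:
  "(\<lambda>n. real (tau_bar (complete_simple_graph n))) \<in> \<Omega>(\<lambda>n. ln (ln (real n)))"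
\<comment> \<open>With \<open>L / 24 < 2 ^ h\<close>, the size \<open>2 ^ h - 1\<close> exceeds
  \<open>L / 24 - 1\<close>, which is at least \<open>L / 48\<close> once
  \<open>L \<ge> 48\<close>.\<close>
proof (rule landau_omega.bigI[of "1 / 48"])
  have "eventually (\<lambda>n. ln (ln (real n)) \<ge> 48) at_top" "eventually (\<lambda>n. ln (real n) > 1) at_top"
    by real_asymp+
  then show "eventually (\<lambda>n. norm (real (tau_bar (complete_simple_graph n))) \<ge>
               1 / 48 * norm (ln (ln (real n)))) at_top"
    using eventually_gt_at_top[of 0]
  proof eventually_elim
    case (elim n)
    define L where "L = ln (ln (real n))"
    \<comment> \<open>Rounding down to a power of two loses at most a factor 2. The divisor 12 is
      chosen because \<open>8 * ln 4 < 8 * 1.4 < 12\<close>.\<close>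
    obtain h where h: "2 ^ h \<le> nat \<lfloor>L / 12\<rfloor>" "nat \<lfloor>L / 12\<rfloor> < 2 ^ (h + 1)"
      using ex_power_ivl1[of 2 "nat \<lfloor>L / 12\<rfloor>"] elim(1) by (auto simp: L_def le_nat_floor)
    have "real (2 ^ h) \<le> L / 12" using h(1) elim(1) unfolding L_def by linarith
    moreover have "L / 12 < real (2 ^ (h + 1))" using h(2) elim(1) unfolding L_def by linarith
    ultimately have h': "2 ^ h \<le> L / 12" "L / 24 < 2 ^ h" by simp_all
    have "h > 0" using h'(2) elim(1) by (cases h) (auto simp: L_def)
    have "ln (exp 1) < ln (4::real)" using exp_le by (subst ln_less_cancel_iff) auto
    then have ln4: "ln 4 < (1.4 :: real)" "ln 4 > (1 :: real)"
      using ln2_le_25_over_36 ln_realpow[of 2 2] by auto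
    let ?K = "2 ^ h - 1 :: nat"
    \<comment> \<open>The left side is the iterated logarithm \<open>ln (ln x)\<close> of the
      threshold \<open>x = 4 ^ 4 ^ (8 * ?K)\<close>.\<close>
    have "real (8 * ?K) * ln 4 + ln (ln 4) \<le> L"
    proof -
      have "ln (ln 4) < (1::real)" using ln4 ln_le_minus_one[of "ln 4 :: real"] by linarith
      moreover have "real ?K = 2 ^ h - 1" by (simp add: of_nat_diff)
      moreover have "real ?K * ln 4 \<le> real ?K * 1.4" using ln4 by (intro mult_left_mono) auto
      ultimately show ?thesis using h'(1) elim(1) unfolding L_def[symmetric] by (simp add: algebra_simps)
    qed
    then have "n \<ge> 4 ^ 4 ^ (8 * ?K)"
    proof -
      assume le: "real (8 * ?K) * ln 4 + ln (ln 4) \<le> L"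
      have "ln (4 ^ (8 * ?K) * ln (4::real)) \<le> ln (ln (real n))"
        using le ln4 by (simp add: ln_mult ln_realpow L_def)
      then have "4 ^ (8 * ?K) * ln (4::real) \<le> ln (real n)"
        using ln4 elim(2) by (subst (asm) ln_le_cancel_iff) auto
      then have "ln (4 ^ 4 ^ (8 * ?K) :: real) \<le> ln (real n)" by (simp add: ln_realpow)
      then have "(4::real) ^ 4 ^ (8 * ?K) \<le> real n"
        using elim(3) by (subst (asm) ln_le_cancel_iff) auto
      then show ?thesis by (simp flip: of_nat_le_iff)
    qed
    then have "2 ^ h - 1 \<le> tau_bar (complete_simple_graph n)"
      using \<open>h > 0\<close> by (rule tau_bar_complete_ge)
    then have "real ?K \<le> real (tau_bar (complete_simple_graph n))" by (rule of_nat_mono)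
    then have "real (tau_bar (complete_simple_graph n)) \<ge> 2 ^ h - 1" by (simp add: of_nat_diff)
    then show ?case using h'(2) elim(1) unfolding L_def by simp
  qed
qed simp

theorem theorem4:
  shows "(\<lambda>n. real (tau_bar (complete_simple_graph n))) \<in> \<Omega>(\<lambda>n. ln (ln (ln (real n))))"
proof -
  \<comment> \<open>The proved bound is stronger than the claim by one logarithm.\<close>
  have "(\<lambda>n::nat. ln (ln (real n))) \<in> \<Omega>(\<lambda>n. ln (ln (ln (real n))))"
    by real_asymp
  with tau_bar_complete_bigomega_lnln show ?thesis by (rule landau_omega.big_trans)
qed
end
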